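(* Let $G=(V,E,w)$ be a finite connected weighted graph with graph Laplacian $L$, and let $(\lambda_k,\psi)$ be the $k$th eigenvalue/eigenvector pair of $L$. Suppose that $\lambda_k$ is simple and that $\psi$ is non-zero at each vertex. Let $E_\pm=\{(i,j)\in E:\psi_i\psi_j<0\}$, $q_{ij}=-\psi_i/\psi_j$, and define, for $\sigma\in[0,1]$, $$B_\sigma(u,v)=\langle u,Lv\rangle+\sigma\Big\langle u,\sum_{(i,j)\in E_\pm}P_{ij}v\Big\rangle,\qquad P_{ij}=w_{ij}\begin{pmatrix} q_{ji}&1\\1&q_{ij}\end{pmatrix},$$ where $P_{ij}$ is supported on the rows and columns $i,j$. Let $\nu(\psi)$ be the number of nodal domains of $\psi$. Then as $\sigma\to1$: (1) there are $k-\nu(\psi)$ eigenvalues (eigenvalue branches) of $B_\sigma$ which cross $\lambda_k$; and (2) the number of eigenvalues (eigenvalue branches) of $B_\sigma$ that converge to $\lambda_k$ is exactly $\nu(\psi)$.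
   Context: $G=(V,E,w)$ is a finite connected weighted undirected graph without self-loops or multiple edges, with weights $w_{ij}=w_{ji}>0$ on edges and $w_{ij}=0$ for non-edges. Its graph Laplacian is $L=D-W$ with $W=(w_{ij})$ and $D$ the diagonal matrix with entries $\sum_j w_{ij}$. Its eigenvalues are listed with multiplicity as $0=\lambda_1\le\lambda_2\le\cdots\le\lambda_{|V|}$. Vectors in $\mathbb{R}^{|V|}$ are functions on $V$, and $\langle\cdot,\cdot\rangle$ is the standard inner product. Edges are unordered, and sums over $E_\pm$ count each edge once. $P_{ij}$ is the $|V|\times|V|$ symmetric matrix with $(i,i)$ entry $w_{ij}q_{ji}$, $(j,j)$ entry $w_{ij}q_{ij}$, $(i,j)$ and $(j,i)$ entries $w_{ij}$, and all other entries zero. The nodal domains of the nowhere-zero vector $\psi$ are the connected components of the graph $(V,E\setminus E_\pm)$, and $\nu(\psi)$ is their number. The eigenvalues of $B_\sigma$ are those of the symmetric matrix $L_\sigma=L+\sigma\sum_{(i,j)\in E_\pm}P_{ij}$. An eigenvalue branch is one of the $|V|$ real-analytic functions $\sigma\mapsto\lambda_i(\sigma)$, $\sigma\in[0,1]$, which together give the eigenvalues of $L_\sigma$ with multiplicity for every $\sigma$. A branch crosses $\lambda_k$ if its value is strictly below $\lambda_k$ at $\sigma=0$ and strictly above $\lambda_k$ at $\sigma=1$. *)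

theory Defs
  imports "HOL-Analysis.Analysis"
begin

(* The vertex set is the finite type 'n.  The unordered edge set is encoded as a symmetric
   irreflexive relation E, so each edge {i,j} contributes both (i,j) and (j,i). *)
definition weighted_graph :: "('n::finite \<times> 'n) set \<Rightarrow> real^'n^'n \<Rightarrow> bool" where
  "weighted_graph E w \<longleftrightarrow>
     sym E \<and> irrefl E \<and>
     (\<forall>i j. w $ i $ j = w $ j $ i) \<and>
     (\<forall>i j. (i, j) \<in> E \<longrightarrow> w $ i $ j > 0) \<and>
     (\<forall>i j. (i, j) \<notin> E \<longrightarrow> w $ i $ j = 0)"

definition connected_graph :: "('n \<times> 'n) set \<Rightarrow> bool" where
  "connected_graph E \<longleftrightarrow> (\<forall>i j. (i, j) \<in> E\<^sup>*)"

(* Meant for symmetric E, for which the closure is an equivalence relation. *)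
definition graph_components :: "('n \<times> 'n) set \<Rightarrow> 'n set set" where
  "graph_components E = UNIV // E\<^sup>*"

definition degree_matrix :: "real^'n^'n \<Rightarrow> real^'n^'n" where
  "degree_matrix w = (\<chi> i j. if i = j then (\<Sum>l\<in>UNIV. w $ i $ l) else 0)"

definition laplacian :: "real^'n^'n \<Rightarrow> real^'n^'n" where
  "laplacian w = degree_matrix w - w"

definition E_pm :: "('n \<times> 'n) set \<Rightarrow> real^'n \<Rightarrow> ('n \<times> 'n) set" where
  "E_pm E \<psi> = {(i, j) \<in> E. \<psi> $ i * \<psi> $ j < 0}"

definition nodal_count :: "('n \<times> 'n) set \<Rightarrow> real^'n \<Rightarrow> nat" where
  "nodal_count E \<psi> = card (graph_components (E - E_pm E \<psi>))"

definition q :: "real^'n \<Rightarrow> 'n \<Rightarrow> 'n \<Rightarrow> real" where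
  "q \<psi> i j = - \<psi> $ i / \<psi> $ j"

definition P :: "real^'n^'n \<Rightarrow> real^'n \<Rightarrow> 'n \<Rightarrow> 'n \<Rightarrow> real^'n^'n" where
  "P w \<psi> i j = (\<chi> a b.
     if a = i \<and> b = i then w $ i $ j * q \<psi> j i
     else if a = j \<and> b = j then w $ i $ j * q \<psi> i j
     else if (a = i \<and> b = j) \<or> (a = j \<and> b = i) then w $ i $ j
     else 0)"

(* The sum of P over the unordered edges in E_pm, each counted once: the relation contains both
   orientations of every edge and P is symmetric in its two vertices (P_commute), hence 1/2. *)
definition P_sum :: "('n \<times> 'n) set \<Rightarrow> real^'n^'n \<Rightarrow> real^'n \<Rightarrow> real^'n^'n" where
  "P_sum E w \<psi> = (1/2) *\<^sub>R (\<Sum>(i, j) \<in> E_pm E \<psi>. P w \<psi> i j)"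

definition B :: "('n::finite \<times> 'n) set \<Rightarrow> real^'n^'n \<Rightarrow> real^'n \<Rightarrow> real
    \<Rightarrow> real^'n \<Rightarrow> real^'n \<Rightarrow> real" where
  "B E w \<psi> \<sigma> u v = u \<bullet> (laplacian w *v v) + \<sigma> * (u \<bullet> (P_sum E w \<psi> *v v))"

(* The matrix representing a bilinear form in the standard basis.  For B it is
   L + sigma * (sum of the P_ij), see form_matrix_B. *)
definition form_matrix :: "(real^'n \<Rightarrow> real^'n \<Rightarrow> real) \<Rightarrow> real^'n^'n" where
  "form_matrix b = (\<chi> i j. b (axis i 1) (axis j 1))"

(* mu 1, ..., mu n (in no particular order) are the eigenvalues of A repeated with multiplicity,
   i.e. the characteristic polynomial of A is the product of the t - mu i. *)
definition eigenvalue_list :: "real^'n^'n \<Rightarrow> (nat \<Rightarrow> real) \<Rightarrow> bool" where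
  "eigenvalue_list A \<mu> \<longleftrightarrow> (\<forall>t. det (mat t - A) = (\<Prod>i\<in>{1..CARD('n)}. t - \<mu> i))"

(* At an end point of a closed interval S the expansion is only required on the S side, which
   amounts to f having an analytic extension past that point. *)
definition real_analytic_on :: "(real \<Rightarrow> real) \<Rightarrow> real set \<Rightarrow> bool" where
  "real_analytic_on f S \<longleftrightarrow>
     (\<forall>x\<in>S. \<exists>r>0. \<exists>a. \<forall>y\<in>S. \<bar>y - x\<bar> < r \<longrightarrow> (\<lambda>m. a m * (y - x) ^ m) sums f y)"

definition eigenvalue_branches ::
    "(real \<Rightarrow> real^'n \<Rightarrow> real^'n \<Rightarrow> real) \<Rightarrow> (nat \<Rightarrow> real \<Rightarrow> real) \<Rightarrow> bool" where
  "eigenvalue_branches b f \<longleftrightarrow>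
     (\<forall>i\<in>{1..CARD('n)}. real_analytic_on (f i) {0..1}) \<and>
     (\<forall>\<sigma>\<in>{0..1}. eigenvalue_list (form_matrix (b \<sigma>)) (\<lambda>i. f i \<sigma>))"

definition crosses :: "(real \<Rightarrow> real) \<Rightarrow> real \<Rightarrow> bool" where
  "crosses g c \<longleftrightarrow> g 0 < c \<and> c < g 1"

lemma P_commute:
  assumes "weighted_graph E w"
  shows "P w \<psi> i j = P w \<psi> j i"
proof -
  have "w $ i $ j = w $ j $ i"
    using assms by (simp add: weighted_graph_def)
  then show ?thesis
    by (auto simp: P_def vec_eq_iff)
qed

lemma form_matrix_B: "form_matrix (B E w \<psi> \<sigma>) = laplacian w + \<sigma> *\<^sub>R P_sum E w \<psi>"
  by (simp add: form_matrix_def B_def vec_eq_iff inner_axis' matrix_vector_mult_basis column_def)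

end

theory Submission
  imports Defs "HOL-Complex_Analysis.Cauchy_Integral_Formula"
begin

text \<open>
  Write \<open>u = \<psi> v\<close> entrywise and \<open>\<lambda> = lam k\<close>.  The eigenvalue equation turns the quadratic form of
  the perturbed Laplacian into a sum over edges,
  \<open>\<langle>u, L\<^sub>\<sigma> u\<rangle> - \<lambda> \<langle>u, u\<rangle> = \<Sum> c\<^sub>i\<^sub>j(\<sigma>) w\<^sub>i\<^sub>j \<psi>\<^sub>i \<psi>\<^sub>j (v\<^sub>i - v\<^sub>j)\<^sup>2\<close>,
  where \<open>c\<^sub>i\<^sub>j(\<sigma>)\<close> is \<open>1 - \<sigma>\<close> on the edges across which \<open>\<psi>\<close> changes sign and \<open>1\<close> on the others
  (lemma \<open>form_matrix_B_edge_sum\<close>).  Three facts are read off.  The form is nondecreasing in \<open>\<sigma>\<close>.  The vector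
  \<open>\<psi>\<close> is an eigenvector with eigenvalue \<open>\<lambda>\<close> for every \<open>\<sigma>\<close>.  At \<open>\<sigma> = 1\<close> the sign-changing edges have
  disappeared, so the form is at least \<open>\<lambda>\<close> and equality holds exactly where \<open>v\<close> is constant on every
  nodal domain, a space of dimension \<open>\<nu>(\<psi>)\<close>.

  Forms are translated into eigenvalues through the spectral theorem: the number of eigenvalues at
  most \<open>c\<close> is the largest dimension of a subspace on which the form is at most \<open>c\<close>
  (\<open>dim_le_card_eigenvalues\<close>, \<open>ex_subspace_card_eigenvalues\<close>).  Hence \<open>\<nu>(\<psi>)\<close> branches end at \<open>\<lambda>\<close> and
  the others end above it, which by continuity is the second claim; and the number of branches at or
  below \<open>\<lambda>\<close> can only decrease with \<open>\<sigma>\<close>, which forces each single branch that starts above \<open>\<lambda>\<close> to stay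
  above it (\<open>branch_stays_positive\<close>).

  For the first claim, \<open>\<lambda>\<close> is an eigenvalue for every \<open>\<sigma>\<close>, so the product of the functions
  \<open>f i - \<lambda>\<close> vanishes identically, and since these are analytic one of them does, say \<open>f j - \<lambda>\<close>.
  Analyticity cannot be replaced by continuity here: two continuous branches could exchange their roles
  at a crossing.  As \<open>\<lambda>\<close> is simple, \<open>j\<close> is the only branch that starts at \<open>\<lambda>\<close>.  The other
  \<open>\<nu>(\<psi>) - 1\<close> branches that end at \<open>\<lambda>\<close> therefore start below it, and of the \<open>k - 1\<close> branches that start
  below \<open>\<lambda>\<close> exactly the remaining \<open>(k - 1) - (\<nu>(\<psi>) - 1) = k - \<nu>(\<psi>)\<close> end above.
\<close>

section \<open>Uniqueness of the list of eigenvalues\<close>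

lemma image_mset_eq_card_filter:
  fixes Q :: "'c \<Rightarrow> bool"
  assumes "image_mset f (mset_set A) = image_mset g (mset_set C)" "finite A" "finite C"
  shows "card {a \<in> A. Q (f a)} = card {b \<in> C. Q (g b)}"
proof -
  have *: "size (filter_mset Q (image_mset h (mset_set S))) = card {a \<in> S. Q (h a)}"
    if "finite S" for h :: "'d \<Rightarrow> 'c" and S
    using that by (simp add: filter_mset_image_mset)
  show ?thesis
    using *[of A f] *[of C g] assms by simp
qed

lemma linear_factors_unique:
  fixes f :: "'a \<Rightarrow> real" and g :: "'b \<Rightarrow> real"
  assumes "finite A" "finite C" "\<And>t. (\<Prod>a\<in>A. t - f a) = (\<Prod>b\<in>C. t - g b)"
  shows "image_mset f (mset_set A) = image_mset g (mset_set C)"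
proof -
  have "poly (\<Prod>a\<in>A. [:- f a, 1:]) t = poly (\<Prod>b\<in>C. [:- g b, 1:]) t" for t
    using assms(3)[of t] by (simp add: poly_prod)
  then have "(\<Prod>a\<in>A. [:- f a, 1:]) = (\<Prod>b\<in>C. [:- g b, 1:])"
    by (simp add: poly_eq_poly_eq_iff[symmetric] fun_eq_iff)
  moreover have "proots (\<Prod>a\<in>S. [:- h a, 1:]) = image_mset h (mset_set S)"
    for h :: "'c \<Rightarrow> real" and S :: "'c set"
    by (subst proots_prod) (auto simp: sum_unfold_sum_mset)
  ultimately show ?thesis by metis
qed

section \<open>Spectral theorem for real symmetric matrices\<close>

text \<open>
  The Rayleigh quotient attains its maximum \<open>m\<close> on the unit sphere of \<open>S\<close> at some \<open>e\<close>.  The residual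
  \<open>r = m e - A e\<close> lies in \<open>S\<close>; if it were nonzero, moving from \<open>e\<close> a little in the direction \<open>- r\<close> would
  raise the quotient above \<open>m\<close>.
\<close>

lemma ex_unit_eigenvector_in_invariant_subspace:
  fixes A :: "real^'n^'n"
  assumes sym: "transpose A = A" and S: "subspace S" "S \<noteq> {0}"
    and inv: "\<And>x. x \<in> S \<Longrightarrow> A *v x \<in> S"
  shows "\<exists>e\<in>S. norm e = 1 \<and> (\<exists>c. A *v e = c *\<^sub>R e)"
proof -
  have adj: "x \<bullet> (A *v y) = (A *v x) \<bullet> y" for x y :: "real^'n"
    by (metis dot_lmul_matrix sym vector_transpose_matrix)
  let ?K = "S \<inter> sphere 0 1"
  obtain x0 where x0: "x0 \<in> S" "x0 \<noteq> 0"
    using S subspace_0 by blast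
  then have "(1 / norm x0) *\<^sub>R x0 \<in> ?K"
    using S by (simp add: subspace_scale)
  then have "?K \<noteq> {}" by blast
  moreover have "compact ?K"
    using closed_subspace[OF S(1)] compact_sphere by (metis closed_Int_compact)
  moreover have "continuous_on ?K (\<lambda>x. x \<bullet> (A *v x))"
    by (intro continuous_intros matrix_vector_mult_linear_continuous_on)
  ultimately obtain e where e: "e \<in> ?K" and max: "\<And>y. y \<in> ?K \<Longrightarrow> y \<bullet> (A *v y) \<le> e \<bullet> (A *v e)"
    by (meson continuous_attains_sup)
  define m where "m = e \<bullet> (A *v e)"
  have ee: "e \<bullet> e = 1" using e by (simp add: norm_eq_1)
  have bound: "x \<bullet> (A *v x) \<le> m * (x \<bullet> x)" if "x \<in> S" for x
  proof (cases "x = 0")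
    case False
    have "(1 / norm x) *\<^sub>R x \<in> ?K"
      using S that False by (simp add: subspace_scale)
    from max[OF this] have "(x \<bullet> (A *v x)) / (norm x)\<^sup>2 \<le> m"
      by (simp add: m_def matrix_vector_mult_scaleR power2_eq_square)
    then show ?thesis
      using False by (simp add: divide_simps power2_norm_eq_inner)
  qed simp
  define r where "r = m *\<^sub>R e - A *v e"
  have rS: "r \<in> S"
    unfolding r_def using e inv S(1) by (intro subspace_diff subspace_scale) auto
  have er: "e \<bullet> r = 0" by (simp add: r_def inner_diff_right ee m_def)
  have Ae: "A *v e = m *\<^sub>R e - r" by (simp add: r_def)
  have rAe: "r \<bullet> (A *v e) = - (r \<bullet> r)" and eAr: "e \<bullet> (A *v r) = - (r \<bullet> r)"
    using er by (auto simp: Ae adj inner_diff_right inner_diff_left inner_commute)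
  have quad: "0 \<le> 2 * t * (r \<bullet> r) + t\<^sup>2 * (m * (r \<bullet> r) - r \<bullet> (A *v r))" for t
  proof -
    have "e + t *\<^sub>R r \<in> S"
      using e rS S(1) by (intro subspace_add subspace_scale) auto
    from bound[OF this] show ?thesis
      using ee er rAe eAr
      by (simp add: matrix_vector_right_distrib matrix_vector_mult_scaleR inner_add_left
          inner_add_right m_def[symmetric] inner_commute[of r e] algebra_simps power2_eq_square)
  qed
  define d where "d = m * (r \<bullet> r) - r \<bullet> (A *v r)"
  have "r = 0"
  proof (rule ccontr)
    assume "r \<noteq> 0"
    then have rr: "r \<bullet> r > 0" by simp
    have d0: "d \<ge> 0" using bound[OF rS] by (simp add: d_def)
    have "0 \<le> 2 * t * (r \<bullet> r) + t\<^sup>2 * d" for t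
      using quad[of t] by (simp add: d_def)
    \<comment> \<open>At this negative \<open>t\<close> the linear term dominates; the \<open>1\<close> keeps the denominator positive if \<open>d = 0\<close>.\<close>
    from this[of "- (r \<bullet> r) / (d + 1)"]
    have "0 \<le> - 2 * (r \<bullet> r)\<^sup>2 / (d + 1) + (r \<bullet> r)\<^sup>2 * d / (d + 1)\<^sup>2"
      by (simp add: power2_eq_square)
    also have "\<dots> = (r \<bullet> r)\<^sup>2 * (- d - 2) / (d + 1)\<^sup>2"
      using d0 by (simp add: divide_simps) (simp add: algebra_simps power2_eq_square)
    also have "\<dots> < 0"
      using d0 rr by (intro divide_neg_pos mult_pos_neg) auto
    finally show False by simp
  qed
  then show ?thesis using e Ae by auto
qed

text \<open>
  A largest orthonormal set of eigenvectors must span the whole space: its orthogonal complement is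
  invariant under \<open>A\<close>, so if it were nonzero it would contain one more unit eigenvector.
\<close>

lemma symmetric_matrix_eigenbasis:
  fixes A :: "real^'n^'n"
  assumes sym: "transpose A = A"
  obtains e :: "'n \<Rightarrow> real^'n" and \<nu> :: "'n \<Rightarrow> real"
  where "\<And>a b. e a \<bullet> e b = (if a = b then 1 else 0)" "\<And>a. A *v e a = \<nu> a *\<^sub>R e a"
proof -
  have adj: "x \<bullet> (A *v y) = (A *v x) \<bullet> y" for x y :: "real^'n"
    by (metis dot_lmul_matrix sym vector_transpose_matrix)
  define ok where "ok X \<longleftrightarrow> pairwise orthogonal X \<and> (\<forall>x\<in>X. norm x = 1 \<and> (\<exists>c. A *v x = c *\<^sub>R x))"
    for X
  have indep: "independent X" if "ok X" for X
    using that by (intro pairwise_orthogonal_independent) (auto simp: ok_def)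
  have "\<exists>X. ok X \<and> (\<forall>Y. ok Y \<longrightarrow> card Y \<le> card X)"
    by (rule ex_has_greatest_nat[where k = "{}" and b = "Suc CARD('n)"])
      (use indep independent_bound in \<open>force simp: ok_def\<close>)+
  then obtain X where X: "ok X" and max: "\<And>Y. ok Y \<Longrightarrow> card Y \<le> card X" by blast
  have fin: "finite X" using indep[OF X] independent_imp_finite by blast
  define S where "S = {y. \<forall>x\<in>X. x \<bullet> y = 0}"
  have sub: "subspace S" by (auto simp: subspace_def S_def inner_add_right)
  have inv: "A *v y \<in> S" if "y \<in> S" for y
    using that X by (fastforce simp: S_def ok_def adj)
  have "S = {0}"
  proof (rule ccontr)
    assume "S \<noteq> {0}"
    from ex_unit_eigenvector_in_invariant_subspace[OF sym sub this inv]
    obtain y c where y: "y \<in> S" "norm y = 1" "A *v y = c *\<^sub>R y" by blast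
    have "y \<notin> X" using y by (auto simp: S_def norm_eq_1)
    moreover have "ok (insert y X)"
      using X y unfolding ok_def
      by (auto simp: pairwise_insert S_def orthogonal_def inner_commute)
    ultimately show False using max[of "insert y X"] fin by simp
  qed
  have "span X = UNIV"
  proof (rule ccontr)
    assume "span X \<noteq> UNIV"
    then obtain z where "z \<noteq> 0" "\<And>y. y \<in> span X \<Longrightarrow> orthogonal z y"
      using orthogonal_to_subspace_exists_gen[of X UNIV] by (metis span_UNIV psubsetI subset_UNIV)
    then have "z \<in> S" by (auto simp: S_def orthogonal_def inner_commute span_base)
    with \<open>S = {0}\<close> \<open>z \<noteq> 0\<close> show False by simp
  qed
  then have "card X = CARD('n)"
    using dim_span_eq_card_independent[OF indep[OF X]] by simp
  then obtain e where e: "bij_betw e (UNIV :: 'n set) X"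
    using fin by (metis finite_same_card_bij finite)
  then have eX: "e a \<in> X" and einj: "e a = e b \<longleftrightarrow> a = b" for a b
    by (auto simp: bij_betw_def inj_eq)
  have "\<exists>c. A *v e a = c *\<^sub>R e a" for a
    using X eX[of a] by (auto simp: ok_def)
  then obtain \<nu> where "\<And>a. A *v e a = \<nu> a *\<^sub>R e a" by metis
  moreover have "e a \<bullet> e b = (if a = b then 1 else 0)" for a b
    using X eX[of a] eX[of b] einj[of a b]
    by (auto simp: ok_def pairwise_def orthogonal_def norm_eq_1)
  ultimately show thesis using that by blast
qed

text \<open>
  The matrix \<open>U\<close> with columns \<open>e a\<close> is orthogonal and diagonalises \<open>A\<close>.
\<close>

lemma det_eigenbasis:
  fixes A :: "real^'n^'n" and e :: "'n \<Rightarrow> real^'n"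
  assumes orth: "\<And>a b. e a \<bullet> e b = (if a = b then 1 else 0)"
    and eig: "\<And>a. A *v e a = \<nu> a *\<^sub>R e a"
  shows "det (mat t - A) = (\<Prod>a\<in>UNIV. t - \<nu> a)"
proof -
  define U :: "real^'n^'n" where "U = (\<chi> i j. e j $ i)"
  define D :: "real^'n^'n" where "D = (\<chi> i j. if i = j then t - \<nu> i else 0)"
  have "transpose U ** U = mat 1"
    using orth by (simp add: vec_eq_iff matrix_matrix_mult_def transpose_def U_def mat_def
        inner_vec_def)
  then have "det U * det U = 1" by (metis det_I det_mul det_transpose)
  then have U0: "det U \<noteq> 0" by auto
  have "((mat t - A) ** U) $ i $ j = (U ** D) $ i $ j" for i j
  proof -
    have "((mat t - A) ** U) $ i $ j = ((mat t - A) *v e j) $ i"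
      by (simp add: matrix_matrix_mult_def matrix_vector_mult_def U_def)
    also have "(mat t - A) *v e j = (t - \<nu> j) *\<^sub>R e j"
    proof -
      have "mat t *v e j = t *\<^sub>R e j"
        by (simp add: vec_eq_iff matrix_vector_mult_def mat_def if_distrib if_distribR cong: if_cong)
      then show ?thesis
        by (simp add: matrix_vector_mult_diff_rdistrib eig scaleR_left_diff_distrib)
    qed
    also have "\<dots> $ i = (U ** D) $ i $ j"
      by (simp add: matrix_matrix_mult_def U_def D_def if_distrib cong: if_cong)
    finally show ?thesis .
  qed
  then have "(mat t - A) ** U = U ** D" by (simp add: vec_eq_iff)
  then have "det (mat t - A) * det U = det U * det D" by (metis det_mul)
  moreover have "det D = (\<Prod>a\<in>UNIV. t - \<nu> a)"
    by (subst det_diagonal) (auto simp: D_def)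
  ultimately show ?thesis using U0 by simp
qed

lemma eigenvalue_list_unique:
  fixes A :: "real^'n^'n"
  assumes "eigenvalue_list A \<mu>" "eigenvalue_list A \<mu>'"
  shows "card {i \<in> {1..CARD('n)}. R (\<mu> i)} = card {i \<in> {1..CARD('n)}. R (\<mu>' i)}"
  using assms
  by (intro image_mset_eq_card_filter linear_factors_unique) (auto simp: eigenvalue_list_def)

lemma span_eigenbasis_form:
  fixes A :: "real^'n^'n" and e :: "'n \<Rightarrow> real^'n"
  assumes orth: "\<And>a b. e a \<bullet> e b = (if a = b then 1 else 0)"
    and eig: "\<And>a. A *v e a = \<nu> a *\<^sub>R e a"
    and u: "u \<in> span (e ` J)"
  obtains x where "u \<bullet> u = (\<Sum>a\<in>J. (x a)\<^sup>2)" "u \<bullet> (A *v u) = (\<Sum>a\<in>J. \<nu> a * (x a)\<^sup>2)"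
proof -
  have inj: "inj_on e J"
    by (rule inj_onI) (metis orth zero_neq_one)
  have "u \<in> range (\<lambda>y. \<Sum>v\<in>e ` J. y v *\<^sub>R v)" using u by (simp add: span_finite)
  then obtain y where "u = (\<Sum>v\<in>e ` J. y v *\<^sub>R v)" by blast
  then have ux: "u = (\<Sum>a\<in>J. y (e a) *\<^sub>R e a)"
    by (simp add: sum.reindex[OF inj])
  define x where "x a = y (e a)" for a
  have eu: "e a \<bullet> u = x a" if "a \<in> J" for a
    using that by (simp add: ux inner_sum_right orth x_def if_distrib cong: if_cong)
  have Au: "A *v u = (\<Sum>a\<in>J. (x a * \<nu> a) *\<^sub>R e a)"
    by (simp add: ux x_def linear_sum[OF matrix_vector_mul_linear] matrix_vector_mult_scaleR eig)
  have "u \<bullet> u = (\<Sum>a\<in>J. x a *\<^sub>R e a) \<bullet> u" by (simp add: ux x_def)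
  also have "\<dots> = (\<Sum>a\<in>J. (x a)\<^sup>2)"
    by (simp add: inner_sum_left eu power2_eq_square)
  finally have 1: "u \<bullet> u = (\<Sum>a\<in>J. (x a)\<^sup>2)" .
  have "u \<bullet> (A *v u) = (\<Sum>a\<in>J. \<nu> a * (x a)\<^sup>2)"
    unfolding Au by (simp add: inner_sum_right inner_commute[of u] eu power2_eq_square algebra_simps)
  with 1 show thesis using that by blast
qed

lemma dim_span_orthonormal:
  fixes e :: "'n::finite \<Rightarrow> real^'n"
  assumes orth: "\<And>a b. e a \<bullet> e b = (if a = b then 1 else 0)"
  shows "dim (span (e ` J)) = card J"
proof -
  have inj: "inj_on e J"
    by (rule inj_onI) (metis orth zero_neq_one)
  have "pairwise orthogonal (e ` J)" 
    by (auto simp: pairwise_def orthogonal_def orth)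
  moreover have "0 \<notin> e ` J" by (metis imageE inner_zero_left orth zero_neq_one)
  ultimately show ?thesis
    using pairwise_orthogonal_independent dim_span_eq_card_independent card_image[OF inj] by metis
qed

text \<open>
  This connects the two descriptions of the spectrum: the roots of the characteristic polynomial agree,
  with multiplicity, with the eigenvalues along an orthonormal eigenbasis.
\<close>

lemma eigenvalue_list_eigenbasis:
  fixes A :: "real^'n^'n"
  assumes "transpose A = A" and l: "eigenvalue_list A \<mu>"
  obtains e :: "'n \<Rightarrow> real^'n" and \<nu> :: "'n \<Rightarrow> real"
  where "\<And>a b. e a \<bullet> e b = (if a = b then 1 else 0)" "\<And>a. A *v e a = \<nu> a *\<^sub>R e a"
    "image_mset \<mu> (mset_set {1..CARD('n)}) = image_mset \<nu> (mset_set UNIV)"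
proof -
  obtain e :: "'n \<Rightarrow> real^'n" and \<nu> where
    e: "\<And>a b. e a \<bullet> e b = (if a = b then 1 else 0)" "\<And>a. A *v e a = \<nu> a *\<^sub>R e a"
    using symmetric_matrix_eigenbasis[OF assms(1)] by blast
  have "(\<Prod>i\<in>{1..CARD('n)}. t - \<mu> i) = (\<Prod>a\<in>UNIV. t - \<nu> a)" for t
    using l det_eigenbasis[OF e, where t=t] by (simp add: eigenvalue_list_def)
  then have "image_mset \<mu> (mset_set {1..CARD('n)}) = image_mset \<nu> (mset_set UNIV)"
    by (intro linear_factors_unique) auto
  with that e show thesis by blast
qed

section \<open>Counting eigenvalues by subspaces\<close>

text \<open>
  On the span \<open>T\<close> of the eigenvectors with eigenvalue above \<open>c\<close> the form exceeds \<open>c\<close> except at \<open>0\<close>.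
  Hence \<open>S\<close> and \<open>T\<close> meet only in \<open>0\<close> and their dimensions add up to at most the dimension of the space.
\<close>

lemma dim_le_card_eigenvalues:
  fixes A :: "real^'n^'n"
  assumes "transpose A = A" "eigenvalue_list A \<mu>" "subspace S"
    and le: "\<And>u. u \<in> S \<Longrightarrow> u \<bullet> (A *v u) \<le> c * (u \<bullet> u)"
  shows "dim S \<le> card {i \<in> {1..CARD('n)}. \<mu> i \<le> c}"
proof -
  obtain e :: "'n \<Rightarrow> real^'n" and \<nu> where
    e: "\<And>a b. e a \<bullet> e b = (if a = b then 1 else 0)" "\<And>a. A *v e a = \<nu> a *\<^sub>R e a"
    and mset: "image_mset \<mu> (mset_set {1..CARD('n)}) = image_mset \<nu> (mset_set UNIV)"
    using eigenvalue_list_eigenbasis[OF assms(1,2)] by metis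
  have card: "card {i \<in> {1..CARD('n)}. R (\<mu> i)} = card {a. R (\<nu> a)}" for R
    using image_mset_eq_card_filter[OF mset, of R] by simp
  define T where "T = span (e ` {a. \<nu> a > c})"
  have "S \<inter> T \<subseteq> {0}"
  proof
    fix u assume u: "u \<in> S \<inter> T"
    then obtain x where uu: "u \<bullet> u = (\<Sum>a | \<nu> a > c. (x a)\<^sup>2)"
      and uAu: "u \<bullet> (A *v u) = (\<Sum>a | \<nu> a > c. \<nu> a * (x a)\<^sup>2)"
      using span_eigenbasis_form[OF e] unfolding T_def by blast
    have nn: "0 \<le> (\<nu> a - c) * (x a)\<^sup>2" if "a \<in> {a. \<nu> a > c}" for a using that by simp
    have le0: "(\<Sum>a | \<nu> a > c. (\<nu> a - c) * (x a)\<^sup>2) \<le> 0"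
      using le[of u] u by (simp add: uu uAu sum_distrib_left left_diff_distrib sum_subtractf)
    have "x a = 0" if a: "\<nu> a > c" for a
    proof -
      have "(\<nu> a - c) * (x a)\<^sup>2 \<le> (\<Sum>a | \<nu> a > c. (\<nu> a - c) * (x a)\<^sup>2)"
        using a nn by (intro member_le_sum) auto
      then show ?thesis using le0 a by (smt (verit) mult_pos_pos zero_less_power2)
    qed
    then show "u \<in> {0}" using uu by simp
  qed
  then have "dim (S \<inter> T) = 0"
    by (simp add: dim_eq_0)
  moreover have "dim {x + y |x y. x \<in> S \<and> y \<in> T} + dim (S \<inter> T) = dim S + dim T"
    by (rule dim_sums_Int) (simp_all add: assms T_def)
  moreover have "dim {x + y |x y. x \<in> S \<and> y \<in> T} \<le> CARD('n)"
    using dim_subset_UNIV_cart by blast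
  moreover have "dim T = card {a. \<nu> a > c}"
    unfolding T_def by (rule dim_span_orthonormal[OF e(1)])
  moreover have "card {a. \<nu> a \<le> c} + card {a. \<nu> a > c} = CARD('n)"
    by (subst card_Un_disjoint[symmetric]) (auto intro!: arg_cong[where f = card])
  ultimately show ?thesis using card[of "\<lambda>t. t \<le> c"] by linarith
qed

text \<open>
  The eigenvectors with eigenvalue at most \<open>c\<close> show that the bound of \<open>dim_le_card_eigenvalues\<close> is attained.
\<close>

lemma ex_subspace_card_eigenvalues:
  fixes A :: "real^'n^'n"
  assumes "transpose A = A" "eigenvalue_list A \<mu>"
  obtains S where "subspace S" "dim S = card {i \<in> {1..CARD('n)}. \<mu> i \<le> c}"
    "\<And>u. u \<in> S \<Longrightarrow> u \<bullet> (A *v u) \<le> c * (u \<bullet> u)"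
proof -
  obtain e :: "'n \<Rightarrow> real^'n" and \<nu> where
    e: "\<And>a b. e a \<bullet> e b = (if a = b then 1 else 0)" "\<And>a. A *v e a = \<nu> a *\<^sub>R e a"
    and mset: "image_mset \<mu> (mset_set {1..CARD('n)}) = image_mset \<nu> (mset_set UNIV)"
    using eigenvalue_list_eigenbasis[OF assms] by metis
  have card: "card {i \<in> {1..CARD('n)}. R (\<mu> i)} = card {a. R (\<nu> a)}" for R
    using image_mset_eq_card_filter[OF mset, of R] by simp
  let ?S = "span (e ` {a. \<nu> a \<le> c})"
  have "u \<bullet> (A *v u) \<le> c * (u \<bullet> u)" if u: "u \<in> ?S" for u
  proof -
    obtain x where "u \<bullet> u = (\<Sum>a | \<nu> a \<le> c. (x a)\<^sup>2)"
      "u \<bullet> (A *v u) = (\<Sum>a | \<nu> a \<le> c. \<nu> a * (x a)\<^sup>2)"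
      using span_eigenbasis_form[OF e u] by blast
    then show ?thesis
      by (auto simp: sum_distrib_left intro!: sum_mono mult_right_mono)
  qed
  moreover have "dim ?S = card {i \<in> {1..CARD('n)}. \<mu> i \<le> c}"
    using dim_span_orthonormal[OF e(1)] card[of "\<lambda>t. t \<le> c"] by metis
  ultimately show thesis using that subspace_span by blast
qed

lemma eigenvalue_ge_if_form_ge:
  fixes A :: "real^'n^'n"
  assumes "transpose A = A" "eigenvalue_list A \<mu>"
    and ge: "\<And>u. c * (u \<bullet> u) \<le> u \<bullet> (A *v u)" and i: "i \<in> {1..CARD('n)}"
  shows "c \<le> \<mu> i"
proof -
  obtain e :: "'n \<Rightarrow> real^'n" and \<nu> where
    e: "\<And>a b. e a \<bullet> e b = (if a = b then 1 else 0)" "\<And>a. A *v e a = \<nu> a *\<^sub>R e a"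
    and mset: "image_mset \<mu> (mset_set {1..CARD('n)}) = image_mset \<nu> (mset_set UNIV)"
    using eigenvalue_list_eigenbasis[OF assms(1,2)] by metis
  have card: "card {i \<in> {1..CARD('n)}. R (\<mu> i)} = card {a. R (\<nu> a)}" for R
    using image_mset_eq_card_filter[OF mset, of R] by simp
  have "\<not> \<nu> a < c" for a
    using ge[of "e a"] by (simp add: e)
  then have "card {i \<in> {1..CARD('n)}. \<mu> i < c} = 0"
    using card[of "\<lambda>t. t < c"] by simp
  then show ?thesis using i by (auto simp: not_less)
qed

section \<open>Real analytic functions on the unit interval\<close>

lemma real_analytic_on_diff_const:
  assumes "real_analytic_on g S"
  shows "real_analytic_on (\<lambda>x. g x - c) S"
  unfolding real_analytic_on_def
proof
  fix x assume "x \<in> S"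
  then obtain r a where r: "r > 0"
    and a: "\<And>y. y \<in> S \<Longrightarrow> \<bar>y - x\<bar> < r \<Longrightarrow> (\<lambda>m. a m * (y - x) ^ m) sums g y"
    using assms unfolding real_analytic_on_def by meson
  define b where "b m = a m - (if m = 0 then c else 0)" for m
  have "(\<lambda>m. b m * (y - x) ^ m) sums (g y - c)" if "y \<in> S" "\<bar>y - x\<bar> < r" for y
  proof -
    have "(\<lambda>m. if m = 0 then c else 0) sums c" using sums_single[of 0 "\<lambda>_. c"] by simp
    from sums_diff[OF a[OF that] this] show ?thesis
      by (rule back_subst[of "\<lambda>h. h sums _"]) (auto simp: b_def fun_eq_iff left_diff_distrib)
  qed
  with r show "\<exists>r>0. \<exists>a. \<forall>y\<in>S. \<bar>y - x\<bar> < r \<longrightarrow> (\<lambda>m. a m * (y - x) ^ m) sums (g y - c)"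
    by blast
qed

text \<open>
  At an end point of the interval the definition of analyticity only speaks of one side.  A power series
  that converges at distance \<open>s\<close> on one side converges in the whole ball of radius \<open>s\<close>, so the library
  on power series becomes applicable after shrinking the radius.
\<close>

lemma real_analytic_on_power_series:
  assumes "real_analytic_on g {0..1}" "x \<in> {0..1}"
  obtains r a where "r > 0"
    "\<And>z. \<bar>z - x\<bar> < r \<Longrightarrow> (\<lambda>m. a m * (z - x) ^ m) sums (\<Sum>m. a m * (z - x) ^ m)"
    "\<And>y. y \<in> {0..1} \<Longrightarrow> \<bar>y - x\<bar> < r \<Longrightarrow> g y = (\<Sum>m. a m * (y - x) ^ m)"
proof -
  obtain r a where r: "r > 0"
    and a: "\<And>y. y \<in> {0..1} \<Longrightarrow> \<bar>y - x\<bar> < r \<Longrightarrow> (\<lambda>m. a m * (y - x) ^ m) sums g y"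
    using assms unfolding real_analytic_on_def by meson
  define s where "s = min (r / 2) (1 / 2)"
  have s: "0 < s" "s < r" "s \<le> 1 / 2" using r by (auto simp: s_def)
  \<comment> \<open>A point of the interval at distance exactly \<open>s\<close>, on whichever side there is room.\<close>
  define y where "y = (if x \<le> 1 / 2 then x + s else x - s)"
  have y: "y \<in> {0..1}" "\<bar>y - x\<bar> = s" using s assms(2) by (auto simp: y_def)
  have "summable (\<lambda>m. a m * (y - x) ^ m)"
    using a[OF y(1)] y(2) s by (simp add: sums_iff)
  then have "summable (\<lambda>m. a m * (z - x) ^ m)" if "\<bar>z - x\<bar> < s" for z
    using that y(2) by (intro powser_inside[of a "y - x" "z - x"]) auto
  moreover have "g z = (\<Sum>m. a m * (z - x) ^ m)" if "z \<in> {0..1}" "\<bar>z - x\<bar> < s" for z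
    using a[of z] that s by (simp add: sums_iff)
  ultimately show thesis using that s(1) by (meson summable_sums)
qed

lemma real_analytic_on_continuous_on:
  assumes "real_analytic_on g {0..1}"
  shows "continuous_on {0..1} g"
proof (rule continuous_on_eq_continuous_within[THEN iffD2, rule_format])
  fix x :: real assume x: "x \<in> {0..1}"
  obtain r a where r: "r > 0"
    and sums: "\<And>z. \<bar>z - x\<bar> < r \<Longrightarrow> (\<lambda>m. a m * (z - x) ^ m) sums (\<Sum>m. a m * (z - x) ^ m)"
    and g: "\<And>y. y \<in> {0..1} \<Longrightarrow> \<bar>y - x\<bar> < r \<Longrightarrow> g y = (\<Sum>m. a m * (y - x) ^ m)"
    using real_analytic_on_power_series[OF assms x] by metis
  let ?h = "\<lambda>z. \<Sum>m. a m * (z - x) ^ m"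
  have "((\<lambda>h. \<Sum>m. a m * h ^ m) \<longlongrightarrow> a 0) (at 0)"
  proof (rule powser_limit_0[OF r])
    show "(\<lambda>m. a m * h ^ m) sums (\<Sum>m. a m * h ^ m)" if "norm h < r" for h
      using sums[of "x + h"] that by simp
  qed
  then have "(?h \<longlongrightarrow> a 0) (at x)"
    by (subst LIM_offset_zero_iff) simp_all
  then have "(?h \<longlongrightarrow> ?h x) (at x within {0..1})"
    by (auto intro: tendsto_within_subset)
  then have "(g \<longlongrightarrow> ?h x) (at x within {0..1})"
    by (rule tendsto_cong[THEN iffD1, rotated])
      (use g r in \<open>auto simp: eventually_at dist_real_def intro!: exI[of _ r]\<close>)
  then show "continuous (at x within {0..1}) g"
    using g[OF x] r by (simp add: continuous_within)
qed

text \<open>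
  Zeros of a power series are isolated unless all its coefficients vanish.
\<close>

lemma real_analytic_on_zero_dichotomy:
  assumes "real_analytic_on g {0..1}" "x \<in> {0..1}"
  shows "\<exists>s>0. (\<forall>y\<in>{0..1}. \<bar>y - x\<bar> < s \<longrightarrow> g y = 0) \<or>
               (\<forall>y\<in>{0..1}. \<bar>y - x\<bar> < s \<longrightarrow> y \<noteq> x \<longrightarrow> g y \<noteq> 0)"
proof -
  obtain r a where r: "r > 0"
    and sums: "\<And>z. \<bar>z - x\<bar> < r \<Longrightarrow> (\<lambda>m. a m * (z - x) ^ m) sums (\<Sum>m. a m * (z - x) ^ m)"
    and g: "\<And>y. y \<in> {0..1} \<Longrightarrow> \<bar>y - x\<bar> < r \<Longrightarrow> g y = (\<Sum>m. a m * (y - x) ^ m)"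
    using real_analytic_on_power_series[OF assms] by metis
  let ?h = "\<lambda>z. \<Sum>m. a m * (z - x) ^ m"
  consider "\<forall>m. a m = 0" | "a 0 \<noteq> 0" | m where "a 0 = 0" "m > 0" "a m \<noteq> 0"
    by (metis neq0_conv)
  then show ?thesis
  proof cases
    case 1
    then show ?thesis using g r by (intro exI[of _ r]) auto
  next
    case 2
    have "g x \<noteq> 0" using g[OF assms(2)] r 2 by simp
    moreover have "(g \<longlongrightarrow> g x) (at x within {0..1})"
      using real_analytic_on_continuous_on[OF assms(1)] assms(2) by (simp add: continuous_on_def)
    ultimately have "eventually (\<lambda>y. g y \<noteq> 0) (at x within {0..1})"
      using tendsto_imp_eventually_ne by blast
    then show ?thesis by (auto simp: eventually_at dist_real_def)
  next
    case 3
    obtain s where s: "s > 0" and nz: "\<And>z. z \<in> cball x s - {x} \<Longrightarrow> ?h z \<noteq> 0"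
    proof (rule powser_0_nonzero[of r x a ?h m])
      show "(\<lambda>n. a n * (z - x) ^ n) sums ?h z" if "norm (z - x) < r" for z
        using sums that by simp
    qed (use 3 r in auto)
    then show ?thesis
      using g r s by (intro exI[of _ "min r s"]) (force simp: dist_real_def)
  qed
qed

text \<open>
  The points near which \<open>g\<close> vanishes form a relatively open set.  By the dichotomy their complement is
  relatively open too, because each neighbourhood of a point of the interval contains further points of it.
\<close>

lemma real_analytic_on_identity:
  assumes g: "real_analytic_on g {0..1}" and s: "s > 0"
    and zero: "\<And>y. y \<in> {0..1} \<Longrightarrow> \<bar>y - a\<bar> < s \<Longrightarrow> g y = 0"
    and a: "a \<in> {0..1}" and b: "b \<in> {0..1}"
  shows "g b = 0"
proof -
  define Z where "Z x \<longleftrightarrow> (\<exists>s>0. \<forall>y\<in>{0..1}. \<bar>y - x\<bar> < s \<longrightarrow> g y = 0)" for x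
  have "Z b"
  proof (rule connected_induction_simple[of "{0..1}" a b])
    show "Z a" using s zero by (auto simp: Z_def)
    fix x :: real assume x: "x \<in> {0..1}"
    obtain s where s: "s > 0" and dich: "(\<forall>y\<in>{0..1}. \<bar>y - x\<bar> < s \<longrightarrow> g y = 0) \<or>
               (\<forall>y\<in>{0..1}. \<bar>y - x\<bar> < s \<longrightarrow> y \<noteq> x \<longrightarrow> g y \<noteq> 0)"
      using real_analytic_on_zero_dichotomy[OF g x] by blast
    let ?T = "{0..1} \<inter> ball x s"
    have "Z y'" if Z: "Z y" and y: "y \<in> ?T" "y' \<in> ?T" for y y'
    proof -
      obtain d where d: "d > 0" "\<And>z. z \<in> {0..1} \<Longrightarrow> \<bar>z - y\<bar> < d \<Longrightarrow> g z = 0"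
        using Z by (auto simp: Z_def)
      have "\<exists>z\<in>{0..1}. \<bar>z - y\<bar> < d \<and> \<bar>z - x\<bar> < s \<and> z \<noteq> x"
      proof (cases "y = x")
        case True
        define t where "t = min (min (d / 2) (s / 2)) (1 / 2)"
        have "0 < t" "t < d" "t < s" "t \<le> 1 / 2" using d s by (auto simp: t_def)
        then show ?thesis
          using True x by (intro bexI[of _ "if x \<le> 1 / 2 then x + t else x - t"]) auto
      next
        case False
        then show ?thesis using y d by (intro bexI[of _ y]) (auto simp: dist_real_def)
      qed
      then have all: "\<forall>y\<in>{0..1}. \<bar>y - x\<bar> < s \<longrightarrow> g y = 0" using d dich by blast
      have "s - \<bar>y' - x\<bar> > 0" using y by (auto simp: dist_real_def)
      moreover have "g z = 0" if "z \<in> {0..1}" "\<bar>z - y'\<bar> < s - \<bar>y' - x\<bar>" for z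
        using all that by auto
      ultimately show ?thesis unfolding Z_def by blast
    qed
    then show "\<exists>T. openin (top_of_set {0..1}) T \<and> x \<in> T \<and> (\<forall>x\<in>T. \<forall>y\<in>T. Z x \<longrightarrow> Z y)"
      using x s by (intro exI[of _ ?T]) (auto simp: openin_open_Int)
  qed (use a b in auto)
  then show ?thesis using b by (auto simp: Z_def)
qed

text \<open>
  The product of nonzero analytic functions is nonzero: otherwise, at a point close enough to \<open>0\<close>, none
  of the finitely many factors would vanish.
\<close>

lemma real_analytic_on_prod_eq_0:
  assumes fin: "finite I" and g: "\<And>i. i \<in> I \<Longrightarrow> real_analytic_on (g i) {0..1}"
    and ex: "\<And>x. x \<in> {0..1} \<Longrightarrow> \<exists>i\<in>I. g i x = 0"
  shows "\<exists>i\<in>I. \<forall>x\<in>{0..1}. g i x = 0"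
proof (rule ccontr)
  assume none: "\<not> ?thesis"
  have "\<exists>s>0. \<forall>y\<in>{0..1}. \<bar>y\<bar> < s \<longrightarrow> y \<noteq> 0 \<longrightarrow> g i y \<noteq> 0" if i: "i \<in> I" for i
  proof -
    obtain s where s: "s > 0" "(\<forall>y\<in>{0..1}. \<bar>y\<bar> < s \<longrightarrow> g i y = 0) \<or>
        (\<forall>y\<in>{0..1}. \<bar>y\<bar> < s \<longrightarrow> y \<noteq> 0 \<longrightarrow> g i y \<noteq> 0)"
      using real_analytic_on_zero_dichotomy[OF g[OF i], of 0] by auto
    moreover have "\<not> (\<forall>y\<in>{0..1}. \<bar>y\<bar> < s \<longrightarrow> g i y = 0)"
    proof
      assume "\<forall>y\<in>{0..1}. \<bar>y\<bar> < s \<longrightarrow> g i y = 0"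
      then have "g i b = 0" if "b \<in> {0..1}" for b
        using real_analytic_on_identity[OF g[OF i] s(1) _ _ that, of 0] by simp
      then show False using none i by blast
    qed
    ultimately show ?thesis by blast
  qed
  then obtain s where s: "\<And>i. i \<in> I \<Longrightarrow> s i > 0"
    and nz: "\<And>i y. i \<in> I \<Longrightarrow> y \<in> {0..1} \<Longrightarrow> \<bar>y\<bar> < s i \<Longrightarrow> y \<noteq> 0 \<Longrightarrow> g i y \<noteq> 0"
    by metis
  define y where "y = Min (insert 1 (s ` I)) / 2"
  have m: "0 < Min (insert 1 (s ` I))" using fin s by simp
  moreover have "Min (insert 1 (s ` I)) \<le> 1" using fin by simp
  ultimately have y: "y > 0" "y \<in> {0..1}" unfolding y_def by auto
  have "\<bar>y\<bar> < s i" if "i \<in> I" for i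
  proof -
    have "Min (insert 1 (s ` I)) \<le> s i" using fin that by (intro Min_le) auto
    then show ?thesis using m unfolding y_def by linarith
  qed
  then show False using ex[OF y(2)] nz[OF _ y(2)] y(1) by blast
qed

section \<open>Sign changes in a family of continuous functions\<close>

text \<open>
  Only the number of nonpositive functions is assumed to decrease, yet every single function keeps its
  sign once it is positive at \<open>0\<close>.  Consider the first point \<open>x\<close> at which \<open>g i\<close> is nonpositive.  Just
  before \<open>x\<close> the functions that are positive at \<open>x\<close> are still positive, so those nonpositive there are
  among those nonpositive at \<open>x\<close>; as there are at least as many, the two sets agree.  Thus \<open>g i\<close> was
  nonpositive before \<open>x\<close> already.
\<close>

lemma branch_stays_positive:
  fixes g :: "'i \<Rightarrow> real \<Rightarrow> real"
  assumes fin: "finite I" and cont: "\<And>i. i \<in> I \<Longrightarrow> continuous_on {0..1} (g i)"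
    and anti: "\<And>x y. 0 \<le> x \<Longrightarrow> x \<le> y \<Longrightarrow> y \<le> 1 \<Longrightarrow>
      card {i \<in> I. g i y \<le> 0} \<le> card {i \<in> I. g i x \<le> 0}"
    and i: "i \<in> I" "g i 0 > 0" and t: "t \<in> {0..1}"
  shows "g i t > 0"
proof (rule ccontr)
  assume "\<not> g i t > 0"
  define Z where "Z = {x \<in> {0..1}. g i x \<le> 0}"
  have "closed Z"
    unfolding Z_def by (intro continuous_closed_preimage_constant continuous_on_closed_Collect_le cont i) auto
  then have "compact Z" by (intro compact_eq_bounded_closed[THEN iffD2] conjI)
      (auto simp: Z_def intro: bounded_subset[OF bounded_closed_interval[of 0 1]])
  moreover have "t \<in> Z" using \<open>\<not> g i t > 0\<close> t by (simp add: Z_def)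
  ultimately obtain x where x: "x \<in> Z" and min: "\<And>z. z \<in> Z \<Longrightarrow> x \<le> z"
    using compact_attains_inf[of Z] by blast
  have x01: "0 \<le> x" "x \<le> 1" "g i x \<le> 0" using x by (auto simp: Z_def)
  then have "x > 0" using i(2) by (cases "x = 0") auto
  \<comment> \<open>Approach \<open>x\<close> from the left inside the interval.\<close>
  let ?F = "at x within {0..<x}"
  have nt: "?F \<noteq> bot" using \<open>x > 0\<close> by (simp add: trivial_limit_within islimpt_Ico)
  have "eventually (\<lambda>y. \<forall>l\<in>{l \<in> I. g l x > 0}. g l y > 0) ?F"
  proof (intro eventually_ball_finite ballI)
    fix l assume l: "l \<in> {l \<in> I. g l x > 0}"
    have "(g l \<longlongrightarrow> g l x) (at x within {0..1})"
      using cont[of l] l x01 by (auto simp: continuous_on_def)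
    then have "(g l \<longlongrightarrow> g l x) ?F"
      using x01 by (elim tendsto_within_subset) auto
    then show "eventually (\<lambda>y. g l y > 0) ?F" using l by (auto dest: order_tendstoD)
  qed (use fin in auto)
  then have "eventually (\<lambda>y. y \<in> {0..<x} \<and> (\<forall>l\<in>{l \<in> I. g l x > 0}. g l y > 0)) ?F"
    by (auto simp: eventually_at_filter elim: eventually_mono)
  then obtain y where y: "y \<in> {0..<x}" and pos: "\<And>l. l \<in> I \<Longrightarrow> g l x > 0 \<Longrightarrow> g l y > 0"
    using eventually_happens'[OF nt] by (metis (mono_tags, lifting) mem_Collect_eq)
  have "{l \<in> I. g l y \<le> 0} \<subseteq> {l \<in> I. g l x \<le> 0}"
    using pos by (auto simp: not_less[symmetric])
  moreover have "card {l \<in> I. g l x \<le> 0} \<le> card {l \<in> I. g l y \<le> 0}"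
    using anti y x01 by simp
  ultimately have "{l \<in> I. g l y \<le> 0} = {l \<in> I. g l x \<le> 0}"
    using fin by (intro card_seteq) auto
  then have "g i y \<le> 0" using i x01 by blast
  then show False using min[of y] y x01 by (auto simp: Z_def)
qed

section \<open>The quadratic form of the perturbed Laplacian\<close>

lemma transpose_form_matrix_B:
  assumes "weighted_graph E w"
  shows "transpose (form_matrix (B E w \<psi> \<sigma>)) = form_matrix (B E w \<psi> \<sigma>)"
proof -
  have "w $ i $ j = w $ j $ i" for i j using assms by (simp add: weighted_graph_def)
  then have "laplacian w $ a $ b = laplacian w $ b $ a" for a b
    by (simp add: laplacian_def degree_matrix_def)
  moreover have "P w \<psi> i j $ a $ b = P w \<psi> i j $ b $ a" for i j a b
    by (cases "a = i"; cases "a = j"; cases "b = i"; cases "b = j") (simp_all add: P_def)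
  then have "P_sum E w \<psi> $ a $ b = P_sum E w \<psi> $ b $ a" for a b
    by (simp add: P_sum_def sum_component split_def)
  ultimately show ?thesis
    by (simp add: form_matrix_B transpose_def vec_eq_iff)
qed

text \<open>
  In this form it is visible that \<open>P\<close> has rank one and kills exactly the vectors \<open>u\<close> for which
  \<open>u / \<psi>\<close> takes the same value at \<open>i\<close> and \<open>j\<close>, in particular \<open>\<psi>\<close> itself, provided that \<open>w\<^sub>i\<^sub>j\<close> is nonzero.
\<close>

lemma P_mult:
  fixes \<psi> u :: "real^'n"
  assumes "i \<noteq> j" "\<psi> $ i \<noteq> 0" "\<psi> $ j \<noteq> 0"
  shows "P w \<psi> i j *v u = (w $ i $ j * (u $ i / \<psi> $ i - u $ j / \<psi> $ j)) *\<^sub>R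
    (\<psi> $ i *\<^sub>R axis j 1 - \<psi> $ j *\<^sub>R axis i 1)"
proof -
  have row: "P w \<psi> i j $ a $ b * u $ b =
      (if b = i then (if a = i then w $ i $ j * q \<psi> j i * u $ i
        else if a = j then w $ i $ j * u $ i else 0) else 0) +
      (if b = j then (if a = i then w $ i $ j * u $ j
        else if a = j then w $ i $ j * q \<psi> i j * u $ j else 0) else 0)" for a b
    using assms(1) by (auto simp: P_def)
  have "(P w \<psi> i j *v u) $ a =
      (if a = i then w $ i $ j * q \<psi> j i * u $ i + w $ i $ j * u $ j
       else if a = j then w $ i $ j * u $ i + w $ i $ j * q \<psi> i j * u $ j else 0)" for a
    unfolding matrix_vector_mult_def by (simp add: row sum.distrib)
  then show ?thesis
    using assms by (simp add: vec_eq_iff axis_def q_def field_simps)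
qed

lemma P_sum_mult: "P_sum E w \<psi> *v u = (1/2) *\<^sub>R (\<Sum>(i, j)\<in>E_pm E \<psi>. P w \<psi> i j *v u)"
proof -
  have "(\<Sum>p\<in>X. M p) *v u = (\<Sum>p\<in>X. M p *v u)" for X :: "('a \<times> 'a) set" and M :: "_ \<Rightarrow> real^'a^'a"
    by (induction X rule: infinite_finite_induct) (auto simp: matrix_vector_mult_add_rdistrib)
  then show ?thesis
    by (simp add: P_sum_def scaleR_matrix_vector_assoc[symmetric] split_def)
qed

text \<open>
  With \<open>u = \<psi> v\<close>, replacing \<open>l \<psi>\<^sub>i\<close> by the \<open>i\<close>th entry of \<open>L \<psi>\<close> cancels the degrees and leaves
  \<open>\<Sum> w\<^sub>i\<^sub>j \<psi>\<^sub>i \<psi>\<^sub>j (v\<^sub>i\<^sup>2 - v\<^sub>i v\<^sub>j)\<close>; averaging with the sum obtained by exchanging \<open>i\<close> and \<open>j\<close> completes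
  the square.
\<close>

lemma laplacian_edge_sum:
  fixes w :: "real^'n^'n"
  assumes sym: "\<And>i j. w $ i $ j = w $ j $ i"
    and eig: "laplacian w *v \<psi> = l *\<^sub>R \<psi>" and nz: "\<And>i. \<psi> $ i \<noteq> 0"
  shows "u \<bullet> (laplacian w *v u) - l * (u \<bullet> u) =
    (\<Sum>i\<in>UNIV. \<Sum>j\<in>UNIV. w $ i $ j * (\<psi> $ i * \<psi> $ j) * (u $ i / \<psi> $ i - u $ j / \<psi> $ j)\<^sup>2) / 2"
proof -
  define v where "v i = u $ i / \<psi> $ i" for i
  have uv: "u $ i = \<psi> $ i * v i" for i using nz by (simp add: v_def)
  have row: "(laplacian w *v x) $ i = (\<Sum>j\<in>UNIV. w $ i $ j * (x $ i - x $ j))" for x :: "real^'n" and i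
  proof -
    have "(laplacian w *v x) $ i =
        (\<Sum>j\<in>UNIV. (if j = i then (\<Sum>l\<in>UNIV. w $ i $ l) * x $ i else 0) - w $ i $ j * x $ j)"
      unfolding matrix_vector_mult_def laplacian_def degree_matrix_def
      by (auto simp: left_diff_distrib intro!: sum.cong)
    then show ?thesis by (simp add: sum_subtractf sum_distrib_right right_diff_distrib)
  qed
  have leig: "l * \<psi> $ i = (\<Sum>j\<in>UNIV. w $ i $ j * (\<psi> $ i - \<psi> $ j))" for i
    using arg_cong[OF eig, of "\<lambda>x. x $ i"] by (simp add: row)
  let ?c = "\<lambda>i j. w $ i $ j * (\<psi> $ i * \<psi> $ j)"
  define X where "X = (\<Sum>i\<in>UNIV. \<Sum>j\<in>UNIV. ?c i j * ((v i)\<^sup>2 - v i * v j))"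
  have "u \<bullet> (laplacian w *v u) - l * (u \<bullet> u) =
      (\<Sum>i\<in>UNIV. u $ i * (laplacian w *v u) $ i - \<psi> $ i * (v i)\<^sup>2 * (l * \<psi> $ i))"
    by (simp add: inner_vec_def sum_subtractf sum_distrib_left uv power2_eq_square algebra_simps)
  also have "\<dots> = X"
    unfolding X_def row leig sum_distrib_left sum_subtractf[symmetric]
    by (intro sum.cong refl) (simp add: uv power2_eq_square algebra_simps)
  finally have 1: "u \<bullet> (laplacian w *v u) - l * (u \<bullet> u) = X" .
  have "X = (\<Sum>i\<in>UNIV. \<Sum>j\<in>UNIV. ?c j i * ((v j)\<^sup>2 - v j * v i))"
    unfolding X_def by (rule sum.swap)
  also have "\<dots> = (\<Sum>i\<in>UNIV. \<Sum>j\<in>UNIV. ?c i j * ((v j)\<^sup>2 - v i * v j))"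
    by (intro sum.cong refl) (metis sym mult.commute)
  finally have "X + X = X + (\<Sum>i\<in>UNIV. \<Sum>j\<in>UNIV. ?c i j * ((v j)\<^sup>2 - v i * v j))"
    by (rule arg_cong)
  also have "\<dots> = (\<Sum>i\<in>UNIV. \<Sum>j\<in>UNIV. ?c i j * (v i - v j)\<^sup>2)"
    unfolding X_def sum.distrib[symmetric]
    by (intro sum.cong refl) (simp add: power2_eq_square algebra_simps)
  finally have "X + X = (\<Sum>i\<in>UNIV. \<Sum>j\<in>UNIV. ?c i j * (v i - v j)\<^sup>2)" .
  with 1 show ?thesis by (simp add: v_def)
qed

text \<open>
  On an edge of \<open>E_pm\<close> the term of \<open>P\<close> is the negative of the term of the Laplacian, so that the
  perturbation fades these edges out.  The sums run over ordered pairs, whence the factor one half.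
\<close>

lemma form_matrix_B_edge_sum:
  fixes w :: "real^'n^'n"
  assumes G: "weighted_graph E w"
    and eig: "laplacian w *v \<psi> = l *\<^sub>R \<psi>" and nz: "\<And>i. \<psi> $ i \<noteq> 0"
  shows "u \<bullet> (form_matrix (B E w \<psi> \<sigma>) *v u) = l * (u \<bullet> u) +
    (\<Sum>i\<in>UNIV. \<Sum>j\<in>UNIV. (if (i, j) \<in> E_pm E \<psi> then 1 - \<sigma> else 1) *
       (w $ i $ j * (\<psi> $ i * \<psi> $ j)) * (u $ i / \<psi> $ i - u $ j / \<psi> $ j)\<^sup>2) / 2"
proof -
  let ?d = "\<lambda>i j. w $ i $ j * (\<psi> $ i * \<psi> $ j) * (u $ i / \<psi> $ i - u $ j / \<psi> $ j)\<^sup>2"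
  have sym: "w $ i $ j = w $ j $ i" for i j using G by (simp add: weighted_graph_def)
  have ne: "i \<noteq> j" if "(i, j) \<in> E_pm E \<psi>" for i j
    using that G by (auto simp: E_pm_def weighted_graph_def irrefl_def)
  have "u \<bullet> (P w \<psi> i j *v u) = - ?d i j" if "(i, j) \<in> E_pm E \<psi>" for i j
    using nz by (simp add: P_mult[OF ne[OF that] nz nz] inner_diff_right inner_axis
        power2_eq_square field_simps)
  then have "u \<bullet> (P_sum E w \<psi> *v u) = (\<Sum>(i, j)\<in>E_pm E \<psi>. - ?d i j) / 2"
    by (auto simp: P_sum_mult inner_sum_right split_def intro!: sum.cong)
  also have "(\<Sum>(i, j)\<in>E_pm E \<psi>. - ?d i j) =
      (\<Sum>(i, j)\<in>UNIV \<times> UNIV. if (i, j) \<in> E_pm E \<psi> then - ?d i j else 0)"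
    by (intro sum.mono_neutral_cong_left) auto
  also have "\<dots> = (\<Sum>i\<in>UNIV. \<Sum>j\<in>UNIV. if (i, j) \<in> E_pm E \<psi> then - ?d i j else 0)"
    by (rule sum.cartesian_product[symmetric])
  finally have Pu: "u \<bullet> (P_sum E w \<psi> *v u) =
      (\<Sum>i\<in>UNIV. \<Sum>j\<in>UNIV. if (i, j) \<in> E_pm E \<psi> then - ?d i j else 0) / 2" .
  have "u \<bullet> (form_matrix (B E w \<psi> \<sigma>) *v u) - l * (u \<bullet> u) =
      (u \<bullet> (laplacian w *v u) - l * (u \<bullet> u)) + \<sigma> * (u \<bullet> (P_sum E w \<psi> *v u))"
    by (simp add: form_matrix_B matrix_vector_mult_add_rdistrib inner_add_right
        scaleR_matrix_vector_assoc[symmetric])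
  also have "\<dots> = (\<Sum>i\<in>UNIV. \<Sum>j\<in>UNIV. ?d i j +
      \<sigma> * (if (i, j) \<in> E_pm E \<psi> then - ?d i j else 0)) / 2"
    unfolding laplacian_edge_sum[OF sym eig nz] Pu
    by (simp add: sum.distrib sum_distrib_left add_divide_distrib)
  also have "\<dots> = (\<Sum>i\<in>UNIV. \<Sum>j\<in>UNIV. (if (i, j) \<in> E_pm E \<psi> then 1 - \<sigma> else 1) *
       (w $ i $ j * (\<psi> $ i * \<psi> $ j)) * (u $ i / \<psi> $ i - u $ j / \<psi> $ j)\<^sup>2) / 2"
    by (intro arg_cong2[where f = "(/)"] sum.cong refl) (auto simp: algebra_simps)
  finally show ?thesis by simp
qed

lemma form_matrix_B_mult_psi:
  fixes w :: "real^'n^'n"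
  assumes G: "weighted_graph E w" and nz: "\<And>i. \<psi> $ i \<noteq> 0"
  shows "form_matrix (B E w \<psi> \<sigma>) *v \<psi> = laplacian w *v \<psi>"
proof -
  have "P w \<psi> i j *v \<psi> = 0" if "(i, j) \<in> E_pm E \<psi>" for i j
  proof -
    have "i \<noteq> j" using that G by (auto simp: E_pm_def weighted_graph_def irrefl_def)
    then show ?thesis using nz by (simp add: P_mult)
  qed
  then have "P_sum E w \<psi> *v \<psi> = 0"
    by (auto simp: P_sum_mult intro!: sum.neutral)
  then show ?thesis
    by (simp add: form_matrix_B matrix_vector_mult_add_rdistrib scaleR_matrix_vector_assoc[symmetric])
qed

text \<open>
  The only coefficients that vary with \<open>\<sigma>\<close> belong to edges on which \<open>\<psi>\<^sub>i \<psi>\<^sub>j\<close> is negative.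
\<close>

lemma form_matrix_B_mono:
  fixes w :: "real^'n^'n"
  assumes G: "weighted_graph E w"
    and eig: "laplacian w *v \<psi> = l *\<^sub>R \<psi>" and nz: "\<And>i. \<psi> $ i \<noteq> 0" and le: "\<sigma> \<le> \<tau>"
  shows "u \<bullet> (form_matrix (B E w \<psi> \<sigma>) *v u) \<le> u \<bullet> (form_matrix (B E w \<psi> \<tau>) *v u)"
proof -
  have "(if (i, j) \<in> E_pm E \<psi> then 1 - \<sigma> else 1) * (w $ i $ j * (\<psi> $ i * \<psi> $ j))
     \<le> (if (i, j) \<in> E_pm E \<psi> then 1 - \<tau> else 1) * (w $ i $ j * (\<psi> $ i * \<psi> $ j))" for i j
  proof (cases "(i, j) \<in> E_pm E \<psi>")
    case True
    then have "w $ i $ j > 0" "\<psi> $ i * \<psi> $ j < 0"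
      using G by (auto simp: E_pm_def weighted_graph_def)
    then have "w $ i $ j * (\<psi> $ i * \<psi> $ j) \<le> 0"
      using mult_pos_neg less_imp_le by blast
    then show ?thesis using True le by (simp add: mult_right_mono_neg)
  qed simp
  then have "(if (i, j) \<in> E_pm E \<psi> then 1 - \<sigma> else 1) * (w $ i $ j * (\<psi> $ i * \<psi> $ j)) *
       (u $ i / \<psi> $ i - u $ j / \<psi> $ j)\<^sup>2
     \<le> (if (i, j) \<in> E_pm E \<psi> then 1 - \<tau> else 1) * (w $ i $ j * (\<psi> $ i * \<psi> $ j)) *
       (u $ i / \<psi> $ i - u $ j / \<psi> $ j)\<^sup>2" for i j
    by (rule mult_right_mono) simp
  note term_le = this
  show ?thesis
    unfolding form_matrix_B_edge_sum[OF G eig nz]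
    by (intro add_left_mono divide_right_mono sum_mono term_le) simp
qed

text \<open>
  At \<open>\<sigma> = 1\<close> only edges with \<open>\<psi>\<^sub>i \<psi>\<^sub>j > 0\<close> remain, so the edge sum has nonnegative terms and vanishes
  only if each of them does.
\<close>

lemma form_matrix_B_1_bound:
  fixes w :: "real^'n^'n"
  assumes G: "weighted_graph E w"
    and eig: "laplacian w *v \<psi> = l *\<^sub>R \<psi>" and nz: "\<And>i. \<psi> $ i \<noteq> 0"
  shows "l * (u \<bullet> u) \<le> u \<bullet> (form_matrix (B E w \<psi> 1) *v u)"
    and "u \<bullet> (form_matrix (B E w \<psi> 1) *v u) \<le> l * (u \<bullet> u) \<longleftrightarrow>
      (\<forall>(i, j)\<in>E - E_pm E \<psi>. u $ i / \<psi> $ i = u $ j / \<psi> $ j)"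
proof -
  define t where "t i j = (if (i, j) \<in> E_pm E \<psi> then 1 - 1 else 1) *
       (w $ i $ j * (\<psi> $ i * \<psi> $ j)) * (u $ i / \<psi> $ i - u $ j / \<psi> $ j)\<^sup>2" for i j
  have form: "u \<bullet> (form_matrix (B E w \<psi> 1) *v u) = l * (u \<bullet> u) +
      (\<Sum>i\<in>UNIV. \<Sum>j\<in>UNIV. t i j) / 2"
    using form_matrix_B_edge_sum[OF G eig nz, of u 1] unfolding t_def .
  have t: "t i j \<ge> 0 \<and> (t i j = 0 \<longleftrightarrow> ((i, j) \<in> E - E_pm E \<psi> \<longrightarrow> u $ i / \<psi> $ i = u $ j / \<psi> $ j))"
    for i j
  proof (cases "(i, j) \<in> E - E_pm E \<psi>")
    case True
    have "\<psi> $ i * \<psi> $ j > 0"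
      using True nz[of i] nz[of j] by (auto simp: E_pm_def not_less order_le_less)
    moreover have "w $ i $ j > 0" using True G by (auto simp: weighted_graph_def)
    ultimately have "w $ i $ j * (\<psi> $ i * \<psi> $ j) > 0" by simp
    then show ?thesis using True by (auto simp: t_def)
  next
    case False
    then have "t i j = 0" using G by (auto simp: t_def weighted_graph_def)
    then show ?thesis using False by (simp only: order_refl simp_thms)
  qed
  then have nn: "(\<Sum>i\<in>UNIV. \<Sum>j\<in>UNIV. t i j) \<ge> 0" by (intro sum_nonneg) auto
  then show "l * (u \<bullet> u) \<le> u \<bullet> (form_matrix (B E w \<psi> 1) *v u)" using form by simp
  have "u \<bullet> (form_matrix (B E w \<psi> 1) *v u) \<le> l * (u \<bullet> u) \<longleftrightarrow>
      (\<Sum>i\<in>UNIV. \<Sum>j\<in>UNIV. t i j) = 0"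
    using nn form by auto
  also have "\<dots> \<longleftrightarrow> (\<forall>i j. t i j = 0)"
    using t by (simp add: sum_nonneg_eq_0_iff sum_nonneg)
  also have "\<dots> \<longleftrightarrow> (\<forall>(i, j)\<in>E - E_pm E \<psi>. u $ i / \<psi> $ i = u $ j / \<psi> $ j)"
    using t by blast
  finally show "u \<bullet> (form_matrix (B E w \<psi> 1) *v u) \<le> l * (u \<bullet> u) \<longleftrightarrow>
      (\<forall>(i, j)\<in>E - E_pm E \<psi>. u $ i / \<psi> $ i = u $ j / \<psi> $ j)" .
qed

section \<open>Nodal domains and the form at the end point\<close>

text \<open>
  The restrictions of \<open>\<psi>\<close> to the components, extended by zero, form an orthogonal basis of this space.
\<close>

lemma dim_ratio_constant_on_components:
  fixes \<psi> :: "real^'n"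
  assumes sym: "sym F" and nz: "\<And>i. \<psi> $ i \<noteq> 0"
  shows "subspace {u :: real^'n. \<forall>(i, j)\<in>F. u $ i / \<psi> $ i = u $ j / \<psi> $ j}" (is "subspace ?S")
    and "dim {u :: real^'n. \<forall>(i, j)\<in>F. u $ i / \<psi> $ i = u $ j / \<psi> $ j} = card (graph_components F)"
proof -
  show "subspace ?S"
    unfolding subspace_def
    by (auto simp: add_divide_distrib split_def simp flip: times_divide_eq_right)
  have eq: "equiv UNIV (F\<^sup>*)"
    by (intro equivI refl_rtrancl sym_rtrancl trans_rtrancl sym) auto
  define b where "b C = (\<chi> i. if i \<in> C then \<psi> $ i else 0)" for C :: "'n set"
  let ?K = "graph_components F"
  have inj: "inj_on b ?K"
  proof (rule inj_onI)
    fix C D assume "b C = b D"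
    then have "i \<in> C \<longleftrightarrow> i \<in> D" for i
      using nz[of i] by (auto simp: b_def vec_eq_iff split: if_splits dest!: spec[of _ i])
    then show "C = D" by blast
  qed
  have inS: "b ` ?K \<subseteq> ?S"
  proof -
    have "i \<in> C \<longleftrightarrow> j \<in> C" if "C \<in> ?K" "(i, j) \<in> F" for C i j
      using that symD[OF sym] unfolding graph_components_def
      by (auto elim!: quotientE intro: rtrancl_into_rtrancl)
    then show ?thesis using nz by (auto simp: b_def)
  qed
  have const: "u $ i / \<psi> $ i = u $ j / \<psi> $ j" if "u \<in> ?S" "(i, j) \<in> F\<^sup>*" for u i j
    using that(2,1) by (induction rule: rtrancl_induct) auto
  have span: "?S \<subseteq> span (b ` ?K)"
  proof
    fix u assume u: "u \<in> ?S"
    define r where "r C = (let c = SOME c. c \<in> C in u $ c / \<psi> $ c)" for C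
    have r: "r (F\<^sup>* `` {i}) = u $ i / \<psi> $ i" for i
    proof -
      have "(SOME c. c \<in> F\<^sup>* `` {i}) \<in> F\<^sup>* `` {i}" by (rule someI[of _ i]) auto
      then show ?thesis using const[OF u] by (auto simp: r_def Let_def)
    qed
    have "u = (\<Sum>C\<in>?K. r C *\<^sub>R b C)"
    proof (rule vec_eq_iff[THEN iffD2, rule_format])
      fix i
      have "(\<Sum>C\<in>?K. r C *\<^sub>R b C) $ i = (\<Sum>C\<in>?K. if C = F\<^sup>* `` {i} then u $ i else 0)"
        unfolding sum_component
      proof (rule sum.cong[OF refl])
        fix C assume "C \<in> ?K"
        then have "i \<in> C \<longleftrightarrow> C = F\<^sup>* `` {i}"
          using eq unfolding graph_components_def
          by (metis Image_singleton_iff UNIV_I equiv_class_eq_iff equiv_class_self quotientE)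
        then show "(r C *\<^sub>R b C) $ i = (if C = F\<^sup>* `` {i} then u $ i else 0)"
          using r[of i] nz by (auto simp: b_def)
      qed
      also have "\<dots> = u $ i"
        by (simp add: graph_components_def quotientI)
      finally show "u $ i = (\<Sum>C\<in>?K. r C *\<^sub>R b C) $ i" by simp
    qed
    then show "u \<in> span (b ` ?K)"
      by (metis (no_types, lifting) imageI span_base span_scale span_sum)
  qed
  have "pairwise orthogonal (b ` ?K)"
  proof -
    have "b C \<bullet> b D = 0" if "C \<in> ?K" "D \<in> ?K" "C \<noteq> D" for C D
    proof -
      have "C \<inter> D = {}"
        using quotient_disj[OF eq] that by (auto simp: graph_components_def)
      then show ?thesis by (auto simp: inner_vec_def b_def intro!: sum.neutral)
    qed
    then show ?thesis by (auto simp: pairwise_def orthogonal_def)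
  qed
  moreover have "0 \<notin> b ` ?K"
  proof
    assume "0 \<in> b ` ?K"
    then obtain C where C: "C \<in> ?K" "b C = 0" by (metis imageE)
    then obtain i where "i \<in> C" using in_quotient_imp_non_empty[OF eq] by (auto simp: graph_components_def)
    then show False using C nz[of i] by (auto simp: b_def vec_eq_iff dest: spec[of _ i])
  qed
  ultimately have "independent (b ` ?K)" by (rule pairwise_orthogonal_independent)
  then show "dim ?S = card ?K"
    using inS span card_image[OF inj] by (intro dim_unique) auto
qed

text \<open>
  The space where \<open>u / \<psi>\<close> is constant on nodal domains contains every subspace on which the form is at
  most \<open>l\<close>, and is one itself; so its dimension is the number sought.
\<close>

lemma card_eigenvalues_B_1:
  fixes w :: "real^'n^'n"
  assumes G: "weighted_graph E w"
    and eig: "laplacian w *v \<psi> = l *\<^sub>R \<psi>" and nz: "\<And>i. \<psi> $ i \<noteq> 0"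
    and \<mu>: "eigenvalue_list (form_matrix (B E w \<psi> 1)) \<mu>"
  shows "card {i \<in> {1..CARD('n)}. \<mu> i \<le> l} = nodal_count E \<psi>"
proof -
  let ?F = "E - E_pm E \<psi>"
  let ?V = "{u :: real^'n. \<forall>(i, j)\<in>?F. u $ i / \<psi> $ i = u $ j / \<psi> $ j}"
  have "sym ?F"
    using G by (auto simp: weighted_graph_def sym_def E_pm_def mult.commute)
  note V = dim_ratio_constant_on_components[OF this nz]
  note tr = transpose_form_matrix_B[OF G]
  note form = form_matrix_B_1_bound(2)[OF G eig nz]
  have "dim ?V \<le> card {i \<in> {1..CARD('n)}. \<mu> i \<le> l}"
    by (rule dim_le_card_eigenvalues[OF tr \<mu> V(1)]) (simp add: form)
  moreover obtain S where S: "dim S = card {i \<in> {1..CARD('n)}. \<mu> i \<le> l}"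
    "\<And>u. u \<in> S \<Longrightarrow> u \<bullet> (form_matrix (B E w \<psi> 1) *v u) \<le> l * (u \<bullet> u)"
    using ex_subspace_card_eigenvalues[OF tr \<mu>] by metis
  have "S \<subseteq> ?V" using S(2) form by blast
  then have "dim S \<le> dim ?V" by (rule dim_subset)
  ultimately show ?thesis using S(1) V(2) by (simp add: nodal_count_def)
qed

section \<open>Counting the branches\<close>

theorem theorem1p1:
  fixes E :: "('n::finite \<times> 'n) set"
    and w :: "real^'n^'n"
    and \<psi> :: "real^'n"
    and lam :: "nat \<Rightarrow> real"
    and k :: nat
    and f :: "nat \<Rightarrow> real \<Rightarrow> real"
  assumes "weighted_graph E w"
    and "connected_graph E"
    and "eigenvalue_list (laplacian w) lam"
    and "mono_on {1..CARD('n)} lam"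
    and "k \<in> {1..CARD('n)}"
    and "laplacian w *v \<psi> = lam k *\<^sub>R \<psi>"
    and simple: "\<forall>j\<in>{1..CARD('n)}. j \<noteq> k \<longrightarrow> lam j \<noteq> lam k"
    and "\<forall>i. \<psi> $ i \<noteq> 0"
    and "eigenvalue_branches (B E w \<psi>) f"
  shows "int (card {i \<in> {1..CARD('n)}. crosses (f i) (lam k)}) = int k - int (nodal_count E \<psi>)
    \<and> card {i \<in> {1..CARD('n)}. (f i \<longlongrightarrow> lam k) (at_left 1)} = nodal_count E \<psi>"
proof -
  let ?I = "{1..CARD('n)}" and ?L = "\<lambda>\<sigma>. form_matrix (B E w \<psi> \<sigma>)" and ?l = "lam k"
  note G = assms(1) and eig = assms(6)
  have nz: "\<psi> $ i \<noteq> 0" for i using assms(8) by blast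
  note tr = transpose_form_matrix_B[OF G, of \<psi>]
  have an: "real_analytic_on (f i) {0..1}" if "i \<in> ?I" for i
    using assms(9) that by (simp add: eigenvalue_branches_def)
  have ev: "eigenvalue_list (?L \<sigma>) (\<lambda>i. f i \<sigma>)" if "\<sigma> \<in> {0..1}" for \<sigma>
    using assms(9) that by (simp add: eigenvalue_branches_def)
  have cont: "continuous_on {0..1} (\<lambda>\<sigma>. f i \<sigma> - ?l)" if "i \<in> ?I" for i
    using real_analytic_on_continuous_on[OF an[OF that]] by (intro continuous_intros)

  \<comment> \<open>A subspace on which the form at \<open>\<tau>\<close> is at most \<open>\<lambda>\<close> serves for every smaller \<open>\<sigma>\<close> as well.\<close>
  have anti: "card {i \<in> ?I. f i \<tau> - ?l \<le> 0} \<le> card {i \<in> ?I. f i \<sigma> - ?l \<le> 0}"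
    if "0 \<le> \<sigma>" "\<sigma> \<le> \<tau>" "\<tau> \<le> 1" for \<sigma> \<tau>
  proof -
    have \<sigma>\<tau>: "\<sigma> \<in> {0..1}" "\<tau> \<in> {0..1}" using that by auto
    obtain S where S: "subspace S" "dim S = card {i \<in> ?I. f i \<tau> \<le> ?l}"
      "\<And>u. u \<in> S \<Longrightarrow> u \<bullet> (?L \<tau> *v u) \<le> ?l * (u \<bullet> u)"
      using ex_subspace_card_eigenvalues[OF tr ev[OF \<sigma>\<tau>(2)], of ?l] by blast
    have "dim S \<le> card {i \<in> ?I. f i \<sigma> \<le> ?l}"
      using S(3) form_matrix_B_mono[OF G eig nz that(2)]
      by (intro dim_le_card_eigenvalues[OF tr ev[OF \<sigma>\<tau>(1)] S(1)]) (blast intro: order_trans)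
    then show ?thesis using S(2) by simp
  qed
  have stay: "f i 1 > ?l" if "i \<in> ?I" "f i 0 > ?l" for i
    using branch_stays_positive[of ?I "\<lambda>i \<sigma>. f i \<sigma> - ?l" i 1] cont anti that by simp

  \<comment> \<open>Since \<open>\<psi>\<close> is an eigenvector for every \<open>\<sigma>\<close>, some analytic branch is constantly \<open>\<lambda>\<close>.\<close>
  have "\<exists>i\<in>?I. f i \<sigma> - ?l = 0" if \<sigma>: "\<sigma> \<in> {0..1}" for \<sigma>
  proof -
    have "mat ?l *v \<psi> = ?l *\<^sub>R \<psi>"
      by (simp add: vec_eq_iff matrix_vector_mult_def mat_def if_distrib if_distribR cong: if_cong)
    then have "(mat ?l - ?L \<sigma>) *v \<psi> = 0"
      using form_matrix_B_mult_psi[OF G nz] eig by (simp add: matrix_vector_mult_diff_rdistrib)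
    moreover have "\<psi> \<noteq> 0" using nz by (metis zero_index)
    ultimately have "det (mat ?l - ?L \<sigma>) = 0"
      by (metis invertible_det_nz invertible_left_inverse matrix_left_invertible_ker)
    then show ?thesis using ev[OF \<sigma>] by (auto simp: eigenvalue_list_def)
  qed
  then obtain j where j: "j \<in> ?I" and jl: "\<And>\<sigma>. \<sigma> \<in> {0..1} \<Longrightarrow> f j \<sigma> = ?l"
    using real_analytic_on_prod_eq_0[of ?I "\<lambda>i \<sigma>. f i \<sigma> - ?l"] real_analytic_on_diff_const[OF an]
    by auto

  \<comment> \<open>The initial values are the numbers \<open>lam i\<close> in some order, so statements that only count
     them can be checked on the sorted list.\<close>
  have ev0: "eigenvalue_list (laplacian w) (\<lambda>i. f i 0)"
    using ev[of 0] by (simp add: form_matrix_B)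
  have "{i \<in> ?I. lam i = ?l} = {k}" using simple assms(5) by auto
  then have "card {i \<in> ?I. f i 0 = ?l} = 1"
    using eigenvalue_list_unique[OF ev0 assms(3), of "\<lambda>t. t = ?l"] by simp
  then obtain j' where j': "{i \<in> ?I. f i 0 = ?l} = {j'}"
    by (rule card_1_singletonE)
  have eq_j': "i = j'" if "i \<in> ?I" "f i 0 = ?l" for i
  proof -
    have "i \<in> {i \<in> ?I. f i 0 = ?l}" using that by simp
    then show ?thesis unfolding j' by simp
  qed
  then have only_j: "i = j" if "i \<in> ?I" "f i 0 = ?l" for i
    using eq_j'[OF that] eq_j'[OF j] jl[of 0] by simp
  have "{i \<in> ?I. lam i < ?l} = {1..<k}"
  proof -
    have "lam i < ?l \<longleftrightarrow> i < k" if "i \<in> ?I" for i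
    proof (cases "i < k")
      case True
      then have "lam i \<le> ?l" using mono_onD[OF assms(4) that assms(5)] by simp
      moreover have "lam i \<noteq> ?l" using bspec[OF simple that] True by simp
      ultimately show ?thesis using True by simp
    next
      case False
      then show ?thesis using mono_onD[OF assms(4) assms(5) that] by simp
    qed
    then show ?thesis using assms(5) by auto
  qed
  then have below: "card {i \<in> ?I. f i 0 < ?l} = k - 1"
    using eigenvalue_list_unique[OF ev0 assms(3), of "\<lambda>t. t < ?l"] by simp

  have ge1: "?l \<le> f i 1" if "i \<in> ?I" for i
    using eigenvalue_ge_if_form_ge[OF tr ev[of 1] form_matrix_B_1_bound(1)[OF G eig nz] that]
    by simp
  let ?Z = "{i \<in> ?I. f i 1 = ?l}"
  have "{i \<in> ?I. f i 1 \<le> ?l} = ?Z" using ge1 by force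
  then have Z: "card ?Z = nodal_count E \<psi>"
    using card_eigenvalues_B_1[OF G eig nz ev[of 1]] by simp
  have jZ: "j \<in> ?Z" using j jl[of 1] by simp
  \<comment> \<open>A branch that ends at \<open>\<lambda>\<close> did not start above it, and only \<open>j\<close> starts at it.\<close>
  have sub: "?Z - {j} \<subseteq> {i \<in> ?I. f i 0 < ?l}"
  proof
    fix i assume "i \<in> ?Z - {j}"
    then have i: "i \<in> ?I" "f i 1 = ?l" "i \<noteq> j" by auto
    then have "\<not> f i 0 > ?l" "f i 0 \<noteq> ?l" using stay[of i] only_j[of i] by auto
    then show "i \<in> {i \<in> ?I. f i 0 < ?l}" using i(1) by simp
  qed
  have "{i \<in> ?I. crosses (f i) ?l} = {i \<in> ?I. f i 0 < ?l} - (?Z - {j})"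
  proof -
    have "crosses (f i) ?l \<longleftrightarrow> f i 0 < ?l \<and> \<not> (f i 1 = ?l \<and> i \<noteq> j)" if "i \<in> ?I" for i
      using ge1[OF that] jl[of 0] by (cases "i = j") (auto simp: crosses_def)
    then show ?thesis by blast
  qed
  then have "card {i \<in> ?I. crosses (f i) ?l} = (k - 1) - (nodal_count E \<psi> - 1)"
    using sub Z jZ below by (simp add: card_Diff_subset)
  moreover have "nodal_count E \<psi> - 1 \<le> k - 1"
    using card_mono[OF _ sub] Z jZ below by simp
  moreover have "nodal_count E \<psi> > 0"
    using card_gt_0_iff[of ?Z] Z jZ by auto
  ultimately have 1: "int (card {i \<in> ?I. crosses (f i) ?l}) = int k - int (nodal_count E \<psi>)"
    using assms(5) by auto

  have "(f i \<longlongrightarrow> ?l) (at_left 1) \<longleftrightarrow> f i 1 = ?l" if "i \<in> ?I" for i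
  proof -
    have "(f i \<longlongrightarrow> f i 1) (at 1 within {0..1})"
      using real_analytic_on_continuous_on[OF an[OF that]] by (simp add: continuous_on_def)
    then have lim: "(f i \<longlongrightarrow> f i 1) (at_left 1)"
      by (simp add: at_within_Icc_at_left)
    have "f i 1 = ?l" if "(f i \<longlongrightarrow> ?l) (at_left 1)"
      using tendsto_unique[OF trivial_limit_at_left_real lim that] .
    with lim show ?thesis by metis
  qed
  then have "{i \<in> ?I. (f i \<longlongrightarrow> ?l) (at_left 1)} = ?Z" by auto
  with 1 Z show ?thesis by simp
qed

end
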